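(* Let $K$ be a commutative ring with unit, $\lambda\in K$, $X$ a well-ordered set, and $\Omega=\{D\}$ with $D$ a unary operator symbol. With respect to the order $>$ on $\mathcal{Q}(X)$ defined in the context, the set $$S=\{D(uv)-D(u)v-uD(v)-\lambda D(u)D(v)\mid u,v\in\mathcal{Q}(X)\}$$ is a Gröbner-Shirshov basis in $K[X;D]$.
   Context: Algebras are associative and not necessarily unital. For a set $Y$, $CS(Y)$ is the free commutative semigroup on $Y$ (nonempty commutative words). Put $\mathcal{Q}_0=CS(X)$, $\Gamma_n=X\cup\{D(u)\mid u\in\mathcal{Q}_{n-1}\}$ (formal expressions) and $\mathcal{Q}_n=CS(\Gamma_n)$ for $n\ge1$, and $\mathcal{Q}(X)=\bigcup_{n\ge0}\mathcal{Q}_n$. Each $u\in\mathcal{Q}(X)$ is uniquely (up to order of factors) a product $u_1\cdots u_n$ with $n\ge1$ and $u_i\in X\cup D(\mathcal{Q}(X))$; put $bre(u)=n$. Let $deg(u)$ be the number of occurrences of elements of $X$ in $u$ (e.g. $deg(x_1D(D(x_2))D(x_3))=3$). $K[X;D]$ is the commutative $K$-algebra with $K$-basis $\mathcal{Q}(X)$, with $D$ extended $K$-linearly. $\mathcal{Q}^\star(X)$ is the set of elements of $\mathcal{Q}(X\cup\{\star\})$, $\star\notin X$, in which $\star$ occurs exactly once. For $u\in\mathcal{Q}^\star(X)$ and $s\in K[X;D]$, $u|_s$ is obtained by replacing $\star$ by $s$ in $u$. The order $>$ on $\mathcal{Q}(X)$ is defined recursively (by induction on $n$ for $\mathcal{Q}_n$).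 On $X\cup D(\mathcal{Q}(X))$: elements of $X$ are compared by the given order of $X$; every $D(u')$ is greater than every element of $X$; $D(u')>D(v')$ iff $u'>v'$. For $u,v\in\mathcal{Q}(X)$ write $u=w_1^{i_1}\cdots w_t^{i_t}$, $v=w_1^{j_1}\cdots w_t^{j_t}$ with $w_1>w_2>\cdots>w_t$ in $X\cup D(\mathcal{Q}(X))$ and exponents $i_k,j_k\ge0$; then $u>v$ iff $(deg(u),i_1,\dots,i_t)>(deg(v),j_1,\dots,j_t)$ lexicographically. This is a monomial order, i.e. a well order such that $w>v$ implies $u|_w>u|_v$ for all $w,v\in\mathcal{Q}(X)$, $u\in\mathcal{Q}^\star(X)$. For nonzero $f\in K[X;D]$, $\bar f$ is the largest element of $\mathcal{Q}(X)$ occurring in $f$ with nonzero coefficient; $f$ is monic if the coefficient of $\bar f$ is $1$. Compositions of monic $f,g$: (i) if $w=a\bar f=b\bar g$ for some $a,b\in\mathcal{Q}(X)$ with $bre(w)<bre(\bar f)+bre(\bar g)$, then $(f,g)_w=af-bg$; (ii) if $w=\bar f=u|_{\bar g}$ for some $u\in\mathcal{Q}^\star(X)$, then $(f,g)_w=f-u|_g$. For a set $S$ of monic elements, $(f,g)_w$ is trivial modulo $(S,w)$ if $(f,g)_w=\sum_i\alpha_iu_i|_{s_i}$ (finite sum) with $\alpha_i\in K$, $u_i\in\mathcal{Q}^\star(X)$, $s_i\in S$ and $u_i|_{\overline{s_i}}<w$ for all $i$. $S$ is a Gröbner-Shirshov basis in $K[X;D]$ if every composition $(f,g)_w$ with $f,g\in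 S$ is trivial modulo $(S,w)$. *)

theory Defs
  imports "HOL-Library.Multiset" "HOL-Library.Poly_Mapping"
begin

text \<open>
  A commutative word is a multiset of letters, so the product of words is \<open>+\<close> on multisets.
  A letter is a generator or a formal expression \<open>D(u)\<close>, here \<open>Op u\<close>. The datatype also contains
  the empty word and letters such as \<open>Op {#}\<close>; these are excluded by \<open>Q\<close> below.
\<close>

datatype 'x letter = Gen 'x | Op "'x letter multiset"

type_synonym 'x word = "'x letter multiset"

definition CS :: "'a set \<Rightarrow> 'a multiset set" where
  "CS Y = {u. u \<noteq> {#} \<and> set_mset u \<subseteq> Y}"

primrec Q_stage :: "nat \<Rightarrow> 'x word set" where
  "Q_stage 0 = CS (range Gen)"
| "Q_stage (Suc n) = CS (range Gen \<union> Op ` Q_stage n)"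

definition Q :: "'x word set" where
  "Q = (\<Union>n. Q_stage n)"

definition bre :: "'x word \<Rightarrow> nat" where
  "bre u = size u"

text \<open>The generators occurring in a letter or word, with multiplicity.\<close>

primrec letter_gens :: "'x letter \<Rightarrow> 'x multiset" where
  "letter_gens (Gen x) = {#x#}"
| "letter_gens (Op u) = \<Sum>\<^sub># (image_mset letter_gens u)"

definition gens :: "'x word \<Rightarrow> 'x multiset" where
  "gens u = \<Sum>\<^sub># (image_mset letter_gens u)"

definition deg :: "'x word \<Rightarrow> nat" where
  "deg u = size (gens u)"

lemma sorted_wrt_pred_mono [mono]:
  "R \<le> R' \<Longrightarrow> sorted_wrt R xs \<longrightarrow> sorted_wrt R' xs"
  by (auto intro: sorted_wrt_mono_rel[rotated])

text \<open>
  The recursion defining the order on \<open>Q\<close> descends to words nested strictly less deeply, so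
  its unique solution is the least one, given by the following inductive definition. The list
  \<open>ws\<close> is \<open>w\<^sub>1 > \<dots> > w\<^sub>t\<close>, the letters occurring in \<open>u\<close> or \<open>v\<close>; letters with exponent \<open>0\<close> in both
  words do not affect the comparison. The relation \<open>lex\<close> relates lists of equal length only.
\<close>

inductive letter_gt :: "'x::wellorder letter \<Rightarrow> 'x letter \<Rightarrow> bool"
  and word_gt :: "'x::wellorder word \<Rightarrow> 'x word \<Rightarrow> bool" (infix "\<succ>" 50)
where
  "x > y \<Longrightarrow> letter_gt (Gen x) (Gen y)"
| "letter_gt (Op u) (Gen x)"
| "u \<succ> v \<Longrightarrow> letter_gt (Op u) (Op v)"
| "sorted_wrt letter_gt ws \<Longrightarrow> set ws = set_mset u \<union> set_mset v \<Longrightarrow>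
   (deg u # map (count u) ws, deg v # map (count v) ws) \<in> lex {(i, j). i > j} \<Longrightarrow> u \<succ> v"

text \<open>
  \<open>K[X;D]\<close> is the non-unital subalgebra \<open>KXD\<close> of the monoid algebra on all words.
  The unit \<open>single {#} 1\<close> of the latter does not belong to it.
\<close>

type_synonym ('x, 'k) oppoly = "'x word \<Rightarrow>\<^sub>0 'k"

definition KXD :: "('x, 'k::comm_ring_1) oppoly set" where
  "KXD = {f. Poly_Mapping.keys f \<subseteq> Q}"

abbreviation mon :: "'x word \<Rightarrow> ('x, 'k::comm_ring_1) oppoly" where
  "mon u \<equiv> Poly_Mapping.single u 1"

definition scale :: "'k \<Rightarrow> ('x, 'k::comm_ring_1) oppoly \<Rightarrow> ('x, 'k) oppoly" where
  "scale c f = Poly_Mapping.map ((*) c) f"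

definition Dop :: "('x, 'k::comm_ring_1) oppoly \<Rightarrow> ('x, 'k) oppoly" where
  "Dop f = (\<Sum>u\<in>Poly_Mapping.keys f. scale (Poly_Mapping.lookup f u) (mon {#Op u#}))"

text \<open>
  The alphabet \<open>X \<union> {\<star>}\<close> is the type \<open>'x option\<close>, with \<open>None\<close> as \<open>\<star>\<close>. The substitutions
  \<open>u|\<^sub>w\<close> and \<open>u|\<^sub>s\<close> are \<open>subst_word u w\<close> for a word \<open>w\<close> and \<open>subst_poly u s\<close> for a polynomial \<open>s\<close>.
\<close>

definition Q_star :: "'x option word set" where
  "Q_star = {u \<in> Q. count (gens u) None = 1}"

primrec subst_word_letter :: "'x word \<Rightarrow> 'x option letter \<Rightarrow> 'x word" where
  "subst_word_letter w (Gen y) = (case y of None \<Rightarrow> w | Some x \<Rightarrow> {#Gen x#})"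
| "subst_word_letter w (Op u) = {#Op (\<Sum>\<^sub># (image_mset (subst_word_letter w) u))#}"

definition subst_word :: "'x option word \<Rightarrow> 'x word \<Rightarrow> 'x word" where
  "subst_word u w = \<Sum>\<^sub># (image_mset (subst_word_letter w) u)"

primrec subst_poly_letter ::
    "('x, 'k::comm_ring_1) oppoly \<Rightarrow> 'x option letter \<Rightarrow> ('x, 'k) oppoly" where
  "subst_poly_letter s (Gen y) = (case y of None \<Rightarrow> s | Some x \<Rightarrow> mon {#Gen x#})"
| "subst_poly_letter s (Op u) = Dop (\<Prod>\<^sub># (image_mset (subst_poly_letter s) u))"

definition subst_poly ::
    "'x option word \<Rightarrow> ('x, 'k::comm_ring_1) oppoly \<Rightarrow> ('x, 'k) oppoly" where
  "subst_poly u s = \<Prod>\<^sub># (image_mset (subst_poly_letter s) u)"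

text \<open>\<open>lead f\<close> is meant for nonzero \<open>f\<close>.\<close>

definition lead :: "('x::wellorder, 'k::comm_ring_1) oppoly \<Rightarrow> 'x word" where
  "lead f = (THE u. u \<in> Poly_Mapping.keys f \<and> (\<forall>v\<in>Poly_Mapping.keys f. v \<noteq> u \<longrightarrow> u \<succ> v))"

definition monic :: "('x::wellorder, 'k::comm_ring_1) oppoly \<Rightarrow> bool" where
  "monic f \<longleftrightarrow> f \<noteq> 0 \<and> Poly_Mapping.lookup f (lead f) = 1"

text \<open>\<open>composition f g w h\<close>: \<open>h\<close> is a composition \<open>(f,g)\<^sub>w\<close>.\<close>

inductive composition ::
    "('x::wellorder, 'k::comm_ring_1) oppoly \<Rightarrow> ('x, 'k) oppoly \<Rightarrow> 'x word \<Rightarrow>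
     ('x, 'k) oppoly \<Rightarrow> bool"
  for f g w where
  intersection:
    "a \<in> Q \<Longrightarrow> b \<in> Q \<Longrightarrow> w = a + lead f \<Longrightarrow> w = b + lead g \<Longrightarrow>
     bre w < bre (lead f) + bre (lead g) \<Longrightarrow> composition f g w (mon a * f - mon b * g)"
| inclusion:
    "u \<in> Q_star \<Longrightarrow> w = lead f \<Longrightarrow> w = subst_word u (lead g) \<Longrightarrow>
     composition f g w (f - subst_poly u g)"

definition trivial_mod ::
    "('x::wellorder, 'k::comm_ring_1) oppoly set \<Rightarrow> 'x word \<Rightarrow> ('x, 'k) oppoly \<Rightarrow> bool" where
  "trivial_mod S w h \<longleftrightarrow> (\<exists>(n::nat) \<alpha> u s.
     h = (\<Sum>i<n. scale (\<alpha> i) (subst_poly (u i) (s i))) \<and>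
     (\<forall>i<n. u i \<in> Q_star \<and> s i \<in> S \<and> w \<succ> subst_word (u i) (lead (s i))))"

definition GS_basis :: "('x::wellorder, 'k::comm_ring_1) oppoly set \<Rightarrow> bool" where
  "GS_basis S \<longleftrightarrow> S \<subseteq> KXD \<and> (\<forall>f\<in>S. monic f) \<and>
     (\<forall>f\<in>S. \<forall>g\<in>S. \<forall>w h. composition f g w h \<longrightarrow> trivial_mod S w h)"

end

theory Submission imports Defs begin

text \<open>
  The relation for \<open>(u, v)\<close> has leading word \<open>D(uv)\<close>, a single letter: the other words in it have the
  same degree, but all their letters have smaller degree. Hence there are no intersection
  compositions. An inclusion composition is of one of two kinds. If \<open>uv = ab\<close>, take a common refinement
  \<open>u = pq\<close>, \<open>v = rs\<close>, \<open>a = pr\<close>, \<open>b = qs\<close>; expanding \<open>D\<close> on \<open>(pq)(rs)\<close> and on \<open>(pr)(qs)\<close> down to \<open>p, q, r, s\<close>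
  gives the same result. If \<open>u\<close> contains \<open>D(ab)\<close>, then reducing \<open>D(uv)\<close> by the outer relation and reducing
  \<open>D(ab)\<close> inside \<open>u\<close> commute, because \<open>D(fg) - D(f)g - fD(g) - \<lambda>D(f)D(g)\<close> is additive in \<open>f\<close>.
\<close>

section \<open>The order on words\<close>

lemma gens_simps [simp]:
  "gens {#} = {#}" "gens (add_mset l u) = letter_gens l + gens u" "gens (u + v) = gens u + gens v"
  by (simp_all add: gens_def)

lemma letter_gens_Op [simp]: "letter_gens (Op u) = gens u"
  by (simp add: gens_def)

declare letter_gens.simps(2) [simp del]

lemma deg_simps [simp]:
  "deg {#} = 0" "deg (add_mset l u) = size (letter_gens l) + deg u" "deg (u + v) = deg u + deg v"
  by (simp_all add: deg_def)

lemma size_gens [simp]: "size (gens u) = deg u"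
  by (simp add: deg_def)

lemma size_letter_gens_le_deg: "l \<in># u \<Longrightarrow> size (letter_gens l) \<le> deg u"
  by (induction u) auto

section \<open>Linearity of the order, by induction on nesting depth\<close>

lemma letter_gt_simps [simp]:
  "letter_gt (Gen x) (Gen y) \<longleftrightarrow> x > y"
  "letter_gt (Op u) (Gen x)"
  "\<not> letter_gt (Gen x) (Op u)"
  "letter_gt (Op u) (Op v) \<longleftrightarrow> u \<succ> v"
  by (auto intro: letter_gt_word_gt.intros elim: letter_gt.cases)

text \<open>The order properties are relativised to a set because letters and words are ordered by
  mutual recursion: they are proved for one stage of nesting at a time.\<close>

definition linear_on :: "'x::wellorder letter set \<Rightarrow> bool" where
  "linear_on A \<longleftrightarrow> asymp_on A letter_gt \<and> transp_on A letter_gt \<and> totalp_on A letter_gt"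

lemma linear_on_subset: "linear_on A \<Longrightarrow> B \<subseteq> A \<Longrightarrow> linear_on B"
  unfolding linear_on_def
  by (auto intro: asymp_on_subset transp_on_subset totalp_on_subset)

lemma linear_on_max:
  assumes "linear_on A" "finite A" "A \<noteq> {}"
  obtains m where "m \<in> A" "\<And>l. l \<in> A \<Longrightarrow> l \<noteq> m \<Longrightarrow> letter_gt m l"
proof -
  from assms have "asymp_on A (\<lambda>x y. letter_gt y x)" "transp_on A (\<lambda>x y. letter_gt y x)"
    unfolding linear_on_def asymp_on_def transp_on_def by blast+
  from Finite_Set.bex_max_element[OF assms(2) this assms(3)]
  obtain m where "m \<in> A" "\<forall>x\<in>A. x \<noteq> m \<longrightarrow> \<not> letter_gt x m" by auto
  then have "letter_gt m l" if "l \<in> A" "l \<noteq> m" for l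
    using assms(1) that unfolding linear_on_def totalp_on_def by blast
  with \<open>m \<in> A\<close> show thesis by (rule that)
qed

lemma linear_on_sorted_list:
  assumes "linear_on A" "finite A"
  shows "\<exists>ws. sorted_wrt letter_gt ws \<and> set ws = A"
  using assms(2,1)
proof (induction A rule: finite_psubset_induct)
  case (psubset A)
  show ?case
  proof (cases "A = {}")
    case False
    then obtain m where m: "m \<in> A" "\<And>l. l \<in> A \<Longrightarrow> l \<noteq> m \<Longrightarrow> letter_gt m l"
      using linear_on_max[OF psubset.prems psubset.hyps False] by blast
    have "linear_on (A - {m})" using psubset.prems by (rule linear_on_subset) auto
    then obtain ws where "sorted_wrt letter_gt ws" "set ws = A - {m}"
      using psubset.IH[of "A - {m}"] m(1) by auto
    then have "sorted_wrt letter_gt (m # ws) \<and> set (m # ws) = A" using m by auto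
    then show ?thesis by blast
  qed auto
qed

text \<open>The first position at which the tuples differ decides. As \<open>ws\<close> is
  decreasing and \<open>letter_gt\<close> is asymmetric on it, the positions before that of a letter
  hold exactly the larger letters.\<close>

lemma lex_sorted_iff:
  fixes f g :: "'x::wellorder letter \<Rightarrow> nat"
  assumes "sorted_wrt letter_gt ws" "asymp_on (set ws) letter_gt"
  shows "(map f ws, map g ws) \<in> lex {(i, j). i > j} \<longleftrightarrow>
    (\<exists>l\<in>set ws. f l > g l \<and> (\<forall>m\<in>set ws. letter_gt m l \<longrightarrow> f m = g m))"
  using assms
proof (induction ws)
  case (Cons a ws)
  have as: "asymp_on (set ws) letter_gt" using Cons.prems(2) by (rule asymp_on_subset) auto
  have na: "\<not> letter_gt a a" "\<And>m. m \<in> set ws \<Longrightarrow> letter_gt a m \<and> \<not> letter_gt m a"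
    using Cons.prems by (auto simp: asymp_on_def)
  show ?case using Cons.IH[OF _ as] Cons.prems(1) na by auto
qed auto

text \<open>A list-free form of the lexicographic comparison. Quantifying over all letters is
  harmless, since letters outside both words have count 0 on both sides, and it makes invariance
  under a common factor immediate.\<close>

definition lex_gt :: "'x::wellorder word \<Rightarrow> 'x word \<Rightarrow> bool" where
  "lex_gt u v \<longleftrightarrow> (\<exists>l. count u l > count v l \<and> (\<forall>m. letter_gt m l \<longrightarrow> count u m = count v m))"

lemma word_gt_iff_linear:
  assumes "linear_on (set_mset u \<union> set_mset v)"
  shows "u \<succ> v \<longleftrightarrow> deg u > deg v \<or> deg u = deg v \<and> lex_gt u v"
proof -
  let ?A = "set_mset u \<union> set_mset v"
  have as: "asymp_on ?A letter_gt" using assms by (simp add: linear_on_def)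
  have lex: "(deg u # map (count u) ws, deg v # map (count v) ws) \<in> lex {(i, j). i > j} \<longleftrightarrow>
      deg u > deg v \<or> deg u = deg v \<and> lex_gt u v"
    if "sorted_wrt letter_gt ws" "set ws = ?A" for ws
  proof -
    have "lex_gt u v \<longleftrightarrow> (\<exists>l\<in>?A. count u l > count v l \<and>
        (\<forall>m\<in>?A. letter_gt m l \<longrightarrow> count u m = count v m))"
      unfolding lex_gt_def
      by (metis UnCI count_inI less_nat_zero_code)
    then show ?thesis using lex_sorted_iff[OF that(1)] as that by simp
  qed
  obtain ws where ws: "sorted_wrt letter_gt ws" "set ws = ?A"
    using linear_on_sorted_list[OF assms] by auto
  show ?thesis
  proof
    assume "u \<succ> v"
    then show "deg u > deg v \<or> deg u = deg v \<and> lex_gt u v"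
      by cases (use lex in blast)
  next
    assume "deg u > deg v \<or> deg u = deg v \<and> lex_gt u v"
    then show "u \<succ> v" using ws lex letter_gt_word_gt.intros(4) by blast
  qed
qed

lemma lex_gt_trans:
  assumes "linear_on A" "set_mset u \<union> set_mset v \<union> set_mset w \<subseteq> A" "lex_gt u v" "lex_gt v w"
  shows "lex_gt u w"
proof -
  obtain l where l: "count u l > count v l" "\<And>m. letter_gt m l \<Longrightarrow> count u m = count v m"
    using assms(3) by (auto simp: lex_gt_def)
  obtain k where k: "count v k > count w k" "\<And>m. letter_gt m k \<Longrightarrow> count v m = count w m"
    using assms(4) by (auto simp: lex_gt_def)
  have A: "l \<in> A" "k \<in> A"
    using l(1) k(1) assms(2) by (metis UnCI count_inI less_nat_zero_code subsetD)+
  \<comment> \<open>Transitivity of \<open>letter_gt\<close> is available only in \<open>A\<close>;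
    a letter outside \<open>A\<close> has the same count in \<open>u\<close> and \<open>w\<close>
    anyway.\<close>
  have inA: "m \<in> A" if "count u m \<noteq> count w m" for m
    using that assms(2) by (metis UnCI count_inI subsetD)
  have tr: "x \<in> A \<Longrightarrow> y \<in> A \<Longrightarrow> z \<in> A \<Longrightarrow> letter_gt x y \<Longrightarrow> letter_gt y z \<Longrightarrow> letter_gt x z" for x y z
    using assms(1) by (auto simp: linear_on_def dest: transp_onD)
  \<comment> \<open>The larger of the two deciding letters \<open>l\<close> and \<open>k\<close>
    decides between \<open>u\<close> and \<open>w\<close>.\<close>
  consider "l = k" | "letter_gt l k" | "letter_gt k l"
    using A assms(1) by (metis linear_on_def totalp_onD)
  then show ?thesis
  proof cases
    case 1
    then have "count u l > count w l \<and> (\<forall>m. letter_gt m l \<longrightarrow> count u m = count w m)"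
      using l k by auto
    then show ?thesis by (auto simp: lex_gt_def)
  next
    case 2
    then have "count u l > count w l \<and> (\<forall>m. letter_gt m l \<longrightarrow> count u m = count w m)"
      using l k A inA tr by (metis (no_types, lifting))
    then show ?thesis by (auto simp: lex_gt_def)
  next
    case 3
    then have "count u k > count w k \<and> (\<forall>m. letter_gt m k \<longrightarrow> count u m = count w m)"
      using l k A inA tr by (metis (no_types, lifting))
    then show ?thesis by (auto simp: lex_gt_def)
  qed
qed

text \<open>The largest letter whose counts differ decides; it exists because only finitely many
  letters occur in \<open>u\<close> or \<open>v\<close>.\<close>

lemma lex_gt_total:
  assumes "linear_on (set_mset u \<union> set_mset v)" "u \<noteq> v"
  shows "lex_gt u v \<or> lex_gt v u"
proof -
  define B where "B = {l. count u l \<noteq> count v l}"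
  have sub: "B \<subseteq> set_mset u \<union> set_mset v"
  proof
    fix l assume "l \<in> B"
    then show "l \<in> set_mset u \<union> set_mset v"
      by (auto simp: B_def not_in_iff)
  qed
  then have fin: "finite B" by (rule finite_subset) simp
  have lin: "linear_on B" using assms(1) sub by (rule linear_on_subset)
  have "B \<noteq> {}" using assms(2) by (auto simp: B_def multiset_eq_iff)
  from linear_on_max[OF lin fin this]
  obtain m where m: "m \<in> B" "\<And>l. l \<in> B \<Longrightarrow> l \<noteq> m \<Longrightarrow> letter_gt m l" by blast
  have eq: "count u k = count v k" if "letter_gt k m" for k
  proof (rule ccontr)
    assume "count u k \<noteq> count v k"
    then have k: "k \<in> B" by (simp add: B_def)
    have as: "asymp_on B letter_gt" using lin by (simp add: linear_on_def)
    show False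
      using asymp_onD[OF as k m(1) that] m(2)[OF k] that by blast
  qed
  have "count u m > count v m \<or> count v m > count u m" using m(1) by (auto simp: B_def)
  then show ?thesis using eq unfolding lex_gt_def by (metis (no_types))
qed

text \<open>The induction step on nesting depth: on words over \<open>A\<close> the order is given
  by degree and \<open>lex_gt\<close>, hence is linear, and this carries over to the letters
  \<open>Op u\<close>.\<close>

lemma linear_on_words:
  fixes A :: "'x::wellorder letter set"
  assumes "linear_on A"
  shows "linear_on (range Gen \<union> Op ` {u. set_mset u \<subseteq> A})"
proof -
  have gt: "u \<succ> v \<longleftrightarrow> deg u > deg v \<or> deg u = deg v \<and> lex_gt u v"
    if "set_mset u \<subseteq> A" "set_mset v \<subseteq> A" for u v :: "'x word"
    using assms that by (intro word_gt_iff_linear linear_on_subset[OF assms]) auto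
  have tr: "u \<succ> w" if "u \<succ> v" "v \<succ> w" "set_mset u \<subseteq> A" "set_mset v \<subseteq> A" "set_mset w \<subseteq> A"
    for u v w :: "'x word"
  proof -
    have "lex_gt u v \<Longrightarrow> lex_gt v w \<Longrightarrow> lex_gt u w"
      using lex_gt_trans[OF assms, of u v w] that(3-5) by blast
    then show ?thesis using that(1,2) gt[OF that(3,4)] gt[OF that(4,5)] gt[OF that(3,5)] by linarith
  qed
  have irr: "\<not> u \<succ> u" if "set_mset u \<subseteq> A" for u :: "'x word"
    using gt[OF that that] by (simp add: lex_gt_def)
  have tot: "u \<succ> v \<or> v \<succ> u" if "u \<noteq> v" "set_mset u \<subseteq> A" "set_mset v \<subseteq> A" for u v :: "'x word"
  proof -
    have "lex_gt u v \<or> lex_gt v u"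
      using that by (intro lex_gt_total linear_on_subset[OF assms]) auto
    then show ?thesis using gt[OF that(2,3)] gt[OF that(3,2)] by linarith
  qed
  let ?B = "range Gen \<union> Op ` {u. set_mset u \<subseteq> A}"
  have Op_mem: "Op u \<in> ?B \<longleftrightarrow> set_mset u \<subseteq> A" for u by auto
  have "asymp_on ?B letter_gt"
  proof (rule asymp_onI)
    fix k l assume kl: "k \<in> ?B" "l \<in> ?B" "letter_gt k l"
    show "\<not> letter_gt l k"
    proof (cases k)
      case k: (Op u)
      show ?thesis
      proof (cases l)
        case l: (Op v)
        from kl have "set_mset u \<subseteq> A" "set_mset v \<subseteq> A" "u \<succ> v"
          by (simp_all only: k l Op_mem letter_gt_simps)
        then show ?thesis unfolding k l letter_gt_simps using tr[of u v u] irr by blast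
      qed (simp add: k)
    qed (use kl in \<open>cases l; simp\<close>)
  qed
  moreover have "transp_on ?B letter_gt"
  proof (rule transp_onI)
    fix j k l assume jkl: "j \<in> ?B" "k \<in> ?B" "l \<in> ?B" "letter_gt j k" "letter_gt k l"
    show "letter_gt j l"
    proof (cases l)
      case l: (Op w)
      then obtain u v where jk: "j = Op u" "k = Op v"
        using jkl(4,5) by (cases j; cases k) simp_all
      from jkl have "set_mset u \<subseteq> A" "set_mset v \<subseteq> A" "set_mset w \<subseteq> A" "u \<succ> v" "v \<succ> w"
        by (simp_all only: jk l Op_mem letter_gt_simps)
      then show ?thesis unfolding jk l letter_gt_simps using tr by blast
    next
      case (Gen x)
      then show ?thesis using jkl(4,5) by (cases j; cases k) simp_all
    qed
  qed
  moreover have "totalp_on ?B letter_gt"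
  proof (rule totalp_onI)
    fix k l assume kl: "k \<in> ?B" "l \<in> ?B" "k \<noteq> l"
    show "letter_gt k l \<or> letter_gt l k"
    proof (cases k)
      case k: (Op u)
      show ?thesis
      proof (cases l)
        case l: (Op v)
        from kl have "set_mset u \<subseteq> A" "set_mset v \<subseteq> A" by (simp_all only: k l Op_mem)
        moreover have "u \<noteq> v" using kl k l by blast
        ultimately show ?thesis unfolding k l letter_gt_simps using tot by blast
      qed (simp add: k)
    qed (use kl in \<open>cases l; auto simp: neq_iff\<close>)
  qed
  ultimately show ?thesis by (simp add: linear_on_def)
qed

text \<open>Unlike \<open>Q_stage\<close>, these stages admit the empty word under
  \<open>Op\<close>. They therefore exhaust the datatype, and the order properties hold without
  membership in \<open>Q\<close>.\<close>

fun letter_stage :: "nat \<Rightarrow> 'x letter set" where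
  "letter_stage 0 = {}"
| "letter_stage (Suc n) = range Gen \<union> Op ` {u. set_mset u \<subseteq> letter_stage n}"

lemma linear_on_letter_stage: "linear_on (letter_stage n)"
proof (induction n)
  case 0
  show ?case by (simp add: linear_on_def asymp_on_def transp_on_def)
next
  case (Suc n)
  then show ?case by (simp add: linear_on_words)
qed

lemma letter_stage_mono_Suc: "letter_stage n \<subseteq> letter_stage (Suc n)"
  by (induction n) auto

lemma letter_stage_mono: "m \<le> n \<Longrightarrow> letter_stage m \<subseteq> letter_stage n"
  by (rule lift_Suc_mono_le[of letter_stage, OF letter_stage_mono_Suc])

lemma finite_subset_letter_stage:
  assumes "finite A" "\<And>l. l \<in> A \<Longrightarrow> \<exists>n. l \<in> letter_stage n"
  shows "\<exists>n. A \<subseteq> letter_stage n"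
  using assms
proof (induction A)
  case (insert l A)
  then obtain m n where "l \<in> letter_stage m" "A \<subseteq> letter_stage n" by blast
  then have "insert l A \<subseteq> letter_stage (max m n)"
    using letter_stage_mono[of m "max m n"] letter_stage_mono[of n "max m n"] by auto
  then show ?case by blast
qed auto

lemma letter_in_stage: "\<exists>n. l \<in> letter_stage n"
proof (induction l)
  case (Gen x)
  have "Gen x \<in> letter_stage (Suc 0)" by simp
  then show ?case by blast
next
  case (Op u)
  then obtain n where "set_mset u \<subseteq> letter_stage n"
    using finite_subset_letter_stage[of "set_mset u"] by auto
  then have "Op u \<in> letter_stage (Suc n)" by simp
  then show ?case by blast
qed

text \<open>Finitely many letters lie in a common stage. Two words involve only finitely many
  letters, so \<open>word_gt_iff\<close> can be free of a linearity hypothesis.\<close>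

lemma linear_on_finite:
  assumes "finite A" shows "linear_on A"
  using finite_subset_letter_stage[OF assms letter_in_stage] linear_on_letter_stage
    linear_on_subset by blast

section \<open>Compatibility of the word order with products and with \<open>D\<close>\<close>

lemma letter_gt_asym: "letter_gt k l \<Longrightarrow> \<not> letter_gt l k"
  using linear_on_finite[of "{k, l}"] by (auto simp: linear_on_def asymp_on_def)

lemma word_gt_iff: "u \<succ> v \<longleftrightarrow> deg u > deg v \<or> deg u = deg v \<and> lex_gt u v"
  by (intro word_gt_iff_linear linear_on_finite) simp

lemma word_gt_irrefl [simp]: "\<not> u \<succ> u"
  by (simp add: word_gt_iff lex_gt_def)

lemma word_gt_asym: "u \<succ> v \<Longrightarrow> \<not> v \<succ> u"
  using letter_gt_asym[of "Op u" "Op v"] by simp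

lemma word_gt_add: "u \<succ> v \<Longrightarrow> u + z \<succ> v + z"
  by (auto simp: word_gt_iff lex_gt_def)

text \<open>\<open>D\<close> preserves degree, and if the degrees agree then \<open>Op u\<close>
  itself decides: no larger letter occurs in either word.\<close>

lemma word_gt_Op:
  assumes "u \<succ> v" shows "{#Op u#} \<succ> {#Op v#}"
proof -
  have ne: "u \<noteq> v" using assms by auto
  have "lex_gt {#Op u#} {#Op v#}"
    unfolding lex_gt_def
    using ne letter_gt_asym[of "Op u" "Op v"] assms by (intro exI[of _ "Op u"]) auto
  moreover have "deg {#Op u#} \<ge> deg {#Op v#}"
    using assms by (auto simp: word_gt_iff)
  ultimately show ?thesis by (auto simp: word_gt_iff simp del: deg_simps)
qed

text \<open>Each factor has positive degree, so a letter of \<open>y\<close> or \<open>z\<close> has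
  degree below \<open>deg u\<close> and is smaller than \<open>Op u\<close>. If the total degrees
  tie, \<open>Op u\<close> therefore decides. This bounds the lower terms of a relation and most
  contexts used below.\<close>

lemma word_gt_Op_product:
  assumes "deg y > 0" "deg z > 0" "deg y + deg z \<le> deg u"
  shows "{#Op u#} \<succ> y + z"
proof -
  have lt: "letter_gt (Op u) l" if "l \<in># y + z" for l
  proof (cases l)
    case (Op t)
    have "deg t < deg u"
      using size_letter_gens_le_deg[of l y] size_letter_gens_le_deg[of l z] that assms Op
      by (auto simp:)
    then show ?thesis by (simp add: Op word_gt_iff)
  qed auto
  have "lex_gt {#Op u#} (y + z)"
    unfolding lex_gt_def
  proof (intro exI[of _ "Op u"] conjI allI impI)
    have "Op u \<notin># y + z" using lt[of "Op u"] by auto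
    then show "count (y + z) (Op u) < count {#Op u#} (Op u)" by (simp add: not_in_iff)
    fix m assume m: "letter_gt m (Op u)"
    then have "m \<notin># y + z" using lt[of m] letter_gt_asym by blast
    moreover have "m \<noteq> Op u" using m by auto
    ultimately show "count {#Op u#} m = count (y + z) m" by (simp add: not_in_iff)
  qed
  then show ?thesis using assms by (auto simp: word_gt_iff)
qed

section \<open>Operated words and substitution\<close>

lemma CS_mono: "A \<subseteq> B \<Longrightarrow> CS A \<subseteq> CS B"
  by (auto simp: CS_def)

lemma Q_stage_mono_Suc: "Q_stage n \<subseteq> Q_stage (Suc n)"
proof (induction n)
  case 0
  show ?case by (simp add: CS_mono)
next
  case (Suc n)
  then show ?case unfolding Q_stage.simps by (intro CS_mono Un_mono image_mono order_refl)
qed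

lemma Q_stage_mono: "m \<le> n \<Longrightarrow> Q_stage m \<subseteq> Q_stage n"
  by (rule lift_Suc_mono_le[of Q_stage, OF Q_stage_mono_Suc])

definition Q_letters :: "'x letter set" where
  "Q_letters = range Gen \<union> Op ` Q"

lemma finite_subset_Q_stage:
  assumes "finite A" "A \<subseteq> Q_letters"
  shows "\<exists>n. A \<subseteq> range Gen \<union> Op ` Q_stage n"
  using assms
proof (induction A)
  case (insert l A)
  then obtain m n where "l \<in> range Gen \<union> Op ` Q_stage m" "A \<subseteq> range Gen \<union> Op ` Q_stage n"
    by (auto simp: Q_letters_def Q_def)
  moreover have "Q_stage m \<subseteq> Q_stage (max m n)" "Q_stage n \<subseteq> Q_stage (max m n)"
    by (simp_all add: Q_stage_mono)
  ultimately have "insert l A \<subseteq> range Gen \<union> Op ` Q_stage (max m n)" by blast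
  then show ?case by blast
qed auto

text \<open>The stages increase, so the finitely many letters of a word lie in one stage; membership
  in \<open>Q\<close> can then be checked letter by letter.\<close>

lemma Q_iff: "u \<in> Q \<longleftrightarrow> u \<noteq> {#} \<and> set_mset u \<subseteq> Q_letters"
proof
  assume "u \<in> Q"
  then obtain n where "u \<in> Q_stage n" by (auto simp: Q_def)
  then show "u \<noteq> {#} \<and> set_mset u \<subseteq> Q_letters"
    by (cases n) (simp_all add: CS_def Q_letters_def Q_def, blast+)
next
  assume u: "u \<noteq> {#} \<and> set_mset u \<subseteq> Q_letters"
  then obtain n where "set_mset u \<subseteq> range Gen \<union> Op ` Q_stage n"
    using finite_subset_Q_stage[of "set_mset u"] by auto
  with u have "u \<in> Q_stage (Suc n)" by (auto simp: CS_def)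
  then show "u \<in> Q" unfolding Q_def by blast
qed

lemma Q_letters_simps [simp]: "Gen x \<in> Q_letters" "Op u \<in> Q_letters \<longleftrightarrow> u \<in> Q"
  by (auto simp: Q_letters_def)

lemma Q_induct [consumes 1, case_names word]:
  assumes "u \<in> Q"
    and word: "\<And>u. u \<in> Q \<Longrightarrow> (\<And>v. Op v \<in># u \<Longrightarrow> P v) \<Longrightarrow> P u"
  shows "P u"
proof -
  have "u \<in> Q_stage n \<Longrightarrow> P u" for n u
  proof (induction n arbitrary: u)
    case 0
    show ?case by (rule word) (use 0 in \<open>auto simp: CS_def Q_iff\<close>)
  next
    case (Suc n)
    then have "u \<in> Q" unfolding Q_def by blast
    moreover have "P v" if "Op v \<in># u" for v
      using Suc that by (auto simp: CS_def)
    ultimately show ?case by (rule word)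
  qed
  with assms(1) show ?thesis by (auto simp: Q_def)
qed

lemma Q_ne [simp]: "{#} \<notin> Q"
  by (simp add: Q_iff)

lemma Q_add [simp]: "u \<in> Q \<Longrightarrow> v \<in> Q \<Longrightarrow> u + v \<in> Q"
  by (auto simp: Q_iff)

lemma Q_add_mset: "add_mset l u \<in> Q \<longleftrightarrow> l \<in> Q_letters \<and> (u = {#} \<or> u \<in> Q)"
  by (auto simp: Q_iff)

text \<open>Membership in \<open>Q\<close> matters: \<open>Op {#}\<close> is a letter of the
  datatype of degree 0. Positivity supplies the hypotheses of
  \<open>word_gt_Op_product\<close>.\<close>

lemma deg_pos: "u \<in> Q \<Longrightarrow> deg u > 0"
proof (induction rule: Q_induct)
  case (word u)
  from word.hyps have "u \<noteq> {#}" by auto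
  then obtain l where l: "l \<in># u" by blast
  have "size (letter_gens l) > 0"
  proof (cases l)
    case (Gen x)
    then show ?thesis by simp
  next
    case (Op v)
    then have "deg v > 0" using word.IH l by blast
    then show ?thesis by (simp add: Op)
  qed
  then show ?case using size_letter_gens_le_deg[OF l] by linarith
qed

lemma subst_word_letter_Op [simp]:
  "subst_word_letter w (Op u) = {#Op (subst_word u w)#}"
  by (simp add: subst_word_def)

lemma subst_poly_letter_Op [simp]:
  "subst_poly_letter s (Op u) = Dop (subst_poly u s)"
  by (simp add: subst_poly_def)

declare subst_word_letter.simps(2) [simp del] subst_poly_letter.simps(2) [simp del]

lemma subst_word_simps [simp]:
  "subst_word {#} w = {#}"
  "subst_word (add_mset l u) w = subst_word_letter w l + subst_word u w"
  "subst_word (u + v) w = subst_word u w + subst_word v w"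
  by (simp_all add: subst_word_def)

lemma subst_poly_simps [simp]:
  "subst_poly {#} s = 1"
  "subst_poly (add_mset l u) s = subst_poly_letter s l * subst_poly u s"
  "subst_poly (u + v) s = subst_poly u s * subst_poly v s"
  by (simp_all add: subst_poly_def)

lemma mon_add: "mon (u + v) = mon u * mon v"
  by (simp add: mult_single)

lemma mon_empty [simp]: "mon {#} = 1"
  by (metis single_one)

lemma subst_word_Q: "u \<in> Q \<Longrightarrow> w \<in> Q \<Longrightarrow> subst_word u w \<in> Q"
proof (induction rule: Q_induct)
  case (word u)
  have "subst_word_letter w l \<in> Q" if "l \<in># u" for l
  proof (cases l)
    case (Gen y)
    then show ?thesis using word.prems by (cases y) (auto simp: Q_add_mset)
  next
    case (Op v)
    then show ?thesis using word that by (auto simp: Q_add_mset)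
  qed
  then have "u \<noteq> {#} \<Longrightarrow> subst_word u w \<in> Q"
  proof (induction u)
    case (add l u)
    then show ?case by (cases "u = {#}") auto
  qed simp
  moreover have "u \<noteq> {#}" using word.hyps by auto
  ultimately show ?case by blast
qed

section \<open>Words over the original alphabet as star-free words over the extended one\<close>

definition embed :: "'x word \<Rightarrow> 'x option word" where
  "embed u = image_mset (map_letter Some) u"

lemma embed_simps [simp]:
  "embed {#} = {#}" "embed (add_mset l u) = add_mset (map_letter Some l) (embed u)"
  "embed (u + v) = embed u + embed v"
  by (simp_all add: embed_def)

lemma map_letter_Op [simp]: "map_letter Some (Op u) = Op (embed u)"
  by (simp add: embed_def)

declare letter.map(2) [simp del]

lemma embed_Q: "u \<in> Q \<Longrightarrow> embed u \<in> Q"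
proof (induction rule: Q_induct)
  case (word u)
  have "map_letter Some l \<in> Q_letters" if "l \<in># u" for l
    using word that by (cases l) auto
  then show ?case using word.hyps by (auto simp: Q_iff embed_def)
qed

lemma gens_embed_letter: "None \<notin># letter_gens (map_letter Some l)"
  by (induction l) (auto simp: gens_def embed_def)

lemma gens_embed [simp]: "count (gens (embed u)) None = 0"
  by (induction u) (auto simp: gens_embed_letter not_in_iff[symmetric])

lemma subst_embed_letter: "subst_word_letter w (map_letter Some l) = {#l#}"
proof (induction l)
  case (Op u)
  then have "subst_word (embed u) w = u" by (induction u) auto
  then show ?case by simp
qed simp

lemma subst_embed [simp]: "subst_word (embed u) w = u"
  by (induction u) (simp_all add: subst_embed_letter)

section \<open>Linearity of \<open>D\<close>\<close>

lemma Dop_eq_sum: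
  assumes "finite A" "Poly_Mapping.keys f \<subseteq> A"
  shows "Dop f = (\<Sum>u\<in>A. scale (Poly_Mapping.lookup f u) (mon {#Op u#}))"
  unfolding Dop_def using assms
  by (intro sum.mono_neutral_left) (auto simp: in_keys_iff scale_def intro!: poly_mapping_eqI)

text \<open>Reading scalars as constant polynomials makes the ring laws available for scalar
  multiples.\<close>

lemma scale_eq: "scale c f = Poly_Mapping.single {#} c * f"
  unfolding scale_def using mult_map_scale_conv_mult[of c f] by (simp add: zero_multiset_def)

lemma Dop_add: "Dop (f + g) = Dop f + Dop g"
proof -
  \<comment> \<open>Both sums are extended to one index set; coefficients outside the keys are zero,
    and additivity becomes distributivity.\<close>
  let ?A = "Poly_Mapping.keys f \<union> Poly_Mapping.keys g"
  have "Poly_Mapping.keys (f + g) \<subseteq> ?A" by (rule Poly_Mapping.keys_add)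
  then show ?thesis
    by (simp add: Dop_eq_sum[of ?A] scale_eq lookup_add single_add distrib_right sum.distrib)
qed

lemma lookup_scale: "Poly_Mapping.lookup (scale c f) u = c * Poly_Mapping.lookup f u"
  by (simp add: scale_def map.rep_eq when_def)

lemma Dop_scale: "Dop (scale c f) = scale c (Dop f)"
proof -
  let ?A = "Poly_Mapping.keys f"
  have "Poly_Mapping.keys (scale c f) \<subseteq> ?A" by (auto simp: in_keys_iff lookup_scale)
  then have "Dop (scale c f) = (\<Sum>u\<in>?A. scale (c * Poly_Mapping.lookup f u) (mon {#Op u#}))"
    by (simp add: Dop_eq_sum[of ?A] lookup_scale)
  also have "\<dots> = scale c (Dop f)"
    by (simp add: Dop_def scale_eq sum_distrib_left mult_single flip: mult.assoc)
  finally show ?thesis .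
qed

lemma Dop_mon [simp]: "Dop (mon u) = mon {#Op u#}"
  by (simp add: Dop_eq_sum[of "{u}"] scale_eq mult_single)

lemma scale_minus_one: "scale (- 1) f = - f"
  by (rule poly_mapping_eqI) (simp add: lookup_scale)

lemma Dop_diff: "Dop (f - g) = Dop f - Dop g"
  using Dop_add[of f "scale (-1) g"] Dop_scale[of "-1" g] by (simp add: scale_minus_one)

lemma scale_linear:
  "scale c (f + g) = scale c f + scale c g" "scale c (f - g) = scale c f - scale c g"
  "scale c (f * g) = scale c f * g" "scale c (f * g) = f * scale c g"
  by (simp_all add: scale_eq algebra_simps)

section \<open>Words with exactly one star, and substitution into them\<close>

lemma star_word_split:
  assumes "count (gens u) None = 1"
  obtains l r where "u = add_mset l r" "count (letter_gens l) None = 1" "count (gens r) None = 0"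
proof -
  have "\<exists>l r. u = add_mset l r \<and> count (letter_gens l) None = 1 \<and> count (gens r) None = 0"
    using assms
  proof (induction u)
    case (add l u)
    then consider "count (letter_gens l) None = 1" "count (gens u) None = 0"
      | "count (letter_gens l) None = 0" "count (gens u) None = 1"
      by (auto simp: add_is_1)
    then show ?case
    proof cases
      case 2
      then obtain k r where "u = add_mset k r" "count (letter_gens k) None = 1"
        "count (gens r) None = 0" using add.IH by auto
      with 2 show ?thesis
        by (intro exI[of _ k] exI[of _ "add_mset l r"]) auto
    qed auto
  qed auto
  with that show thesis by blast
qed

lemma star_letter_cases:
  assumes "count (letter_gens l) None = 1"
  obtains "l = Gen None" | u where "l = Op u" "count (gens u) None = 1"
  using assms by (cases l) (auto split: if_splits)

text \<open>The single star lies in a single letter, so a context arises from the star by applying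
  \<open>D\<close> and multiplying by star-free words.\<close>

lemma star_word_induct [consumes 1, case_names star Op]:
  assumes "count (gens u) None = 1"
    and star: "\<And>r. count (gens r) None = 0 \<Longrightarrow> P (add_mset (Gen None) r)"
    and Op: "\<And>u r. count (gens u) None = 1 \<Longrightarrow> P u \<Longrightarrow> count (gens r) None = 0 \<Longrightarrow>
      P (add_mset (Op u) r)"
  shows "P u"
proof -
  \<comment> \<open>The cofactor \<open>r\<close> is arbitrary because the induction meets the
    star-carrying letter of \<open>u\<close> together with the rest of \<open>u\<close>.\<close>
  have letter: "count (letter_gens l) None = 1 \<Longrightarrow> count (gens r) None = 0 \<Longrightarrow> P (add_mset l r)"
    for l r
  proof (induction l arbitrary: r)
    case (Gen y)
    then show ?case by (cases y) (auto intro: star)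
  next
    case (Op u)
    then have u: "count (gens u) None = 1" by simp
    then obtain k t where "u = add_mset k t" "count (letter_gens k) None = 1"
      "count (gens t) None = 0" by (rule star_word_split)
    then have "P u" using Op.IH by auto
    then show ?case using assms(3) u Op.prems by blast
  qed
  from assms(1) show ?thesis by (rule star_word_split) (auto intro: letter)
qed

lemma starless_letter_eq:
  "count (letter_gens l) None = 0 \<Longrightarrow> \<exists>k. l = map_letter Some k"
proof (induction l)
  case (Gen y)
  then show ?case by (cases y) (auto intro: exI[of _ "Gen _"] split: if_splits)
next
  case (Op u)
  then have "\<exists>t. u = embed t"
  proof (induction u)
    case empty
    show ?case by (rule exI[of _ "{#}"]) simp
  next
    case (add l u)
    have "\<exists>k. l = map_letter Some k" using add.prems by auto
    moreover have "\<exists>t. u = embed t" using add by auto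
    ultimately obtain k t where "l = map_letter Some k" "u = embed t" by blast
    then have "add_mset l u = embed (add_mset k t)" by simp
    then show ?case by blast
  qed
  then obtain t where "u = embed t" ..
  then have "Op u = map_letter Some (Op t)" by simp
  then show ?case by blast
qed

lemma starless_eq_embed:
  assumes "count (gens r) None = 0" obtains t where "r = embed t"
proof -
  obtain k where "Op r = map_letter Some k"
    using starless_letter_eq[of "Op r"] assms by auto
  then show thesis using that by (cases k) auto
qed

lemma subst_poly_embed_letter:
  "subst_poly_letter s (map_letter Some l) = mon {#l#}"
proof (induction l)
  case (Op u)
  then have "subst_poly (embed u) s = mon u"
    by (induction u) (auto simp flip: mon_add)
  then show ?case by simp
qed simp

lemma subst_poly_embed [simp]: "subst_poly (embed u) s = mon u"
proof (induction u)
  case (add l u)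
  then show ?case by (simp add: subst_poly_embed_letter flip: mon_add)
qed simp

text \<open>Star-free cofactors are embedded words, on which both substitutions have a known value
  independent of what is substituted.\<close>

lemma star_context_induct [consumes 1, case_names star Op]:
  assumes "count (gens u) None = 1"
    and "\<And>z. P (add_mset (Gen None) (embed z))"
    and "\<And>u z. count (gens u) None = 1 \<Longrightarrow> P u \<Longrightarrow> P (add_mset (Op u) (embed z))"
  shows "P u"
  using assms(1) by (induction rule: star_word_induct) (metis assms(2,3) starless_eq_embed)+

text \<open>With one star, substitution is a composition of maps that multiply by a monomial or
  apply \<open>D\<close>, all linear.\<close>

lemma subst_poly_linear:
  assumes "count (gens u) None = 1"
  shows "subst_poly u (f + g) = subst_poly u f + subst_poly u g"
    and "subst_poly u (f - g) = subst_poly u f - subst_poly u g"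
    and "subst_poly u (scale c f) = scale c (subst_poly u f)"
    and "subst_poly u (mon w) = mon (subst_word u w)"
  using assms
  by (induction rule: star_context_induct)
    (simp_all add: Dop_add Dop_diff Dop_scale distrib_right left_diff_distrib
      scale_linear(3) flip: mon_add)

text \<open>Both steps that build a context, multiplying by a word and applying \<open>D\<close>,
  preserve the order.\<close>

lemma subst_word_gt:
  assumes "count (gens u) None = 1" "w \<succ> w'"
  shows "subst_word u w \<succ> subst_word u w'"
  using assms
proof (induction rule: star_context_induct)
  case (star z)
  then show ?case by (simp add: word_gt_add)
next
  case (Op u z)
  then show ?case using word_gt_add[OF word_gt_Op, of _ _ z] by simp
qed

section \<open>Reduction modulo the Leibniz relations\<close>

text \<open>Defined for polynomials and not only for monomials, because nested overlaps use
  linearity in the first argument.\<close>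

definition leibniz_defect ::
    "'k \<Rightarrow> ('x, 'k::comm_ring_1) oppoly \<Rightarrow> ('x, 'k) oppoly \<Rightarrow> ('x, 'k) oppoly" where
  "leibniz_defect lam f g = Dop (f * g) - Dop f * g - f * Dop g - scale lam (Dop f * Dop g)"

definition leibniz_relations :: "'k \<Rightarrow> ('x, 'k::comm_ring_1) oppoly set" where
  "leibniz_relations lam = {leibniz_defect lam (mon u) (mon v) | u v. u \<in> Q \<and> v \<in> Q}"

lemma leibniz_defect_commute: "leibniz_defect lam f g = leibniz_defect lam g f"
  by (simp add: leibniz_defect_def scale_eq algebra_simps)

lemma leibniz_defect_linear:
  "leibniz_defect lam (f + f') g = leibniz_defect lam f g + leibniz_defect lam f' g"
  "leibniz_defect lam (scale c f) g = scale c (leibniz_defect lam f g)"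
proof -
  show "leibniz_defect lam (f + f') g = leibniz_defect lam f g + leibniz_defect lam f' g"
    by (simp add: leibniz_defect_def Dop_add scale_eq algebra_simps)
  have "Dop (scale c f * g) = scale c (Dop (f * g))"
    by (simp flip: scale_linear(3) Dop_scale)
  then show "leibniz_defect lam (scale c f) g = scale c (leibniz_defect lam f g)"
    by (simp add: leibniz_defect_def Dop_scale) (simp add: scale_eq algebra_simps)
qed

lemma leibniz_defect_mon:
  "leibniz_defect lam (mon u) (mon v) =
    mon {#Op (u + v)#} -
      (mon ({#Op u#} + v) + mon (u + {#Op v#}) + scale lam (mon ({#Op u#} + {#Op v#})))"
  unfolding leibniz_defect_def by (simp only: Dop_mon flip: mon_add) simp

text \<open>Each lower word is a product of one of \<open>u\<close>, \<open>D(u)\<close> and one of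
  \<open>v\<close>, \<open>D(v)\<close>, with degrees \<open>deg u\<close> and \<open>deg v\<close>,
  so \<open>word_gt_Op_product\<close> applies.\<close>

lemma leibniz_lower_words:
  assumes "u \<in> Q" "v \<in> Q" "z \<in> {{#Op u#} + v, u + {#Op v#}, {#Op u#} + {#Op v#}}"
  shows "z \<in> Q" "{#Op (u + v)#} \<succ> z"
proof -
  have "\<exists>x\<in>{u, {#Op u#}}. \<exists>y\<in>{v, {#Op v#}}. z = x + y" using assms(3) by blast
  then obtain x y where z: "x \<in> {u, {#Op u#}}" "y \<in> {v, {#Op v#}}" "z = x + y" by blast
  then have "x \<in> Q" "y \<in> Q" "deg x = deg u" "deg y = deg v"
    using assms(1,2) by (auto simp: Q_add_mset)
  then show "z \<in> Q" "{#Op (u + v)#} \<succ> z"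
    using deg_pos[of x] deg_pos[of y] unfolding z(3) by (auto intro!: word_gt_Op_product)
qed

lemma leibniz_defect_props:
  fixes lam :: "'k::comm_ring_1" and u v :: "'x::wellorder word"
  assumes "u \<in> Q" "v \<in> Q"
  defines "f \<equiv> leibniz_defect lam (mon u) (mon v)"
  shows "f \<in> KXD" "monic f" "lead f = {#Op (u + v)#}"
proof -
  let ?t = "{#Op (u + v)#}"
  let ?Z = "{{#Op u#} + v, u + {#Op v#}, {#Op u#} + {#Op v#}}"
  have gt: "?t \<succ> z" if "z \<in> ?Z" for z
    using leibniz_lower_words[OF assms(1,2)] that by blast
  then have ne: "z \<noteq> ?t" if "z \<in> ?Z" for z using that by force
  have lookup: "Poly_Mapping.lookup f ?t = 1"
  proof -
    have "\<not> {#Op u#} + v = ?t" "\<not> u + {#Op v#} = ?t" "\<not> {#Op u#} + {#Op v#} = ?t"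
      using ne by blast+
    then show ?thesis
      unfolding f_def leibniz_defect_mon
      by (simp only: lookup_minus lookup_add lookup_scale lookup_single when_simps) simp
  qed
  \<comment> \<open>Only an inclusion: lower words may coincide, as for \<open>u = v\<close>, and
    \<open>lam\<close> may be zero.\<close>
  have keys: "Poly_Mapping.keys f \<subseteq> insert ?t ?Z"
  proof
    fix w assume "w \<in> Poly_Mapping.keys f"
    then show "w \<in> insert ?t ?Z"
      unfolding f_def leibniz_defect_mon in_keys_iff
      by (auto simp: lookup_minus lookup_add lookup_scale lookup_single when_def split: if_splits)
  qed
  have t: "?t \<in> Poly_Mapping.keys f" using lookup by (simp add: in_keys_iff)
  have max: "?t \<succ> w" if "w \<in> Poly_Mapping.keys f" "w \<noteq> ?t" for w
    using keys gt that by blast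
  show lead: "lead f = ?t"
    unfolding lead_def
  proof (rule the_equality)
    show "?t \<in> Poly_Mapping.keys f \<and> (\<forall>v\<in>Poly_Mapping.keys f. v \<noteq> ?t \<longrightarrow> ?t \<succ> v)"
      using t max by blast
  next
    fix w assume w: "w \<in> Poly_Mapping.keys f \<and> (\<forall>v\<in>Poly_Mapping.keys f. v \<noteq> w \<longrightarrow> w \<succ> v)"
    show "w = ?t"
    proof (rule ccontr)
      assume "w \<noteq> ?t"
      with w t have "w \<succ> ?t" by metis
      moreover have "?t \<succ> w" using w \<open>w \<noteq> ?t\<close> max by blast
      ultimately show False using word_gt_asym by blast
    qed
  qed
  show "monic f" unfolding monic_def lead using lookup by auto
  have "insert ?t ?Z \<subseteq> Q"
    using leibniz_lower_words(1)[OF assms(1,2)] assms by (auto simp: Q_add_mset)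
  then show "f \<in> KXD" using keys by (auto simp: KXD_def)
qed

section \<open>Triviality is closed under linear combinations\<close>

lemma trivial_mod_0: "trivial_mod S w 0"
  unfolding trivial_mod_def by (intro exI[of _ 0]) simp

lemma trivial_mod_add_context:
  assumes "trivial_mod S w h" "c \<in> Q_star" "s \<in> S" "w \<succ> subst_word c (lead s)"
  shows "trivial_mod S w (h + scale a (subst_poly c s))"
proof -
  obtain n \<alpha> u t where h: "h = (\<Sum>i<n. scale (\<alpha> i) (subst_poly (u i) (t i)))"
    and u: "\<forall>i<n::nat. u i \<in> Q_star \<and> t i \<in> S \<and> w \<succ> subst_word (u i) (lead (t i))"
    using assms(1) unfolding trivial_mod_def by blast
  show ?thesis
    unfolding trivial_mod_def
    \<comment> \<open>The new summand goes to index \<open>n\<close>; the updates leave the old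
      summands untouched.\<close>
    by (rule exI[of _ "Suc n"], rule exI[of _ "\<alpha>(n := a)"], rule exI[of _ "u(n := c)"],
        rule exI[of _ "t(n := s)"])
      (use assms(2-4) u in \<open>auto simp: h less_Suc_eq\<close>)
qed

lemma trivial_mod_context:
  assumes "c \<in> Q_star" "s \<in> S" "w \<succ> subst_word c (lead s)"
  shows "trivial_mod S w (subst_poly c s)"
  using trivial_mod_add_context[OF trivial_mod_0 assms, of 1] by (simp add: scale_eq)

lemma trivial_mod_add:
  assumes "trivial_mod S w h" "trivial_mod S w h'"
  shows "trivial_mod S w (h + h')"
proof -
  obtain n \<alpha> u t where h': "h' = (\<Sum>i<n. scale (\<alpha> i) (subst_poly (u i) (t i)))"
    and "\<forall>i<n::nat. u i \<in> Q_star \<and> t i \<in> S \<and> w \<succ> subst_word (u i) (lead (t i))"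
    using assms(2) unfolding trivial_mod_def by blast
  then have "trivial_mod S w (h + (\<Sum>i<n. scale (\<alpha> i) (subst_poly (u i) (t i))))"
  proof (induction n arbitrary: h')
    case (Suc n)
    then show ?case
      using trivial_mod_add_context[of S w "h + (\<Sum>i<n. scale (\<alpha> i) (subst_poly (u i) (t i)))"]
      by (simp add: add.assoc)
  qed (simp add: assms(1))
  then show ?thesis by (simp add: h')
qed

lemma trivial_mod_scale:
  assumes "trivial_mod S w h"
  shows "trivial_mod S w (scale c h)"
proof -
  obtain n \<alpha> u t where h: "h = (\<Sum>i<n. scale (\<alpha> i) (subst_poly (u i) (t i)))"
    and u: "\<forall>i<n::nat. u i \<in> Q_star \<and> t i \<in> S \<and> w \<succ> subst_word (u i) (lead (t i))"
    using assms unfolding trivial_mod_def by blast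
  have "scale c h = (\<Sum>i<n. scale (c * \<alpha> i) (subst_poly (u i) (t i)))"
    by (simp add: h scale_eq sum_distrib_left mult_single flip: mult.assoc)
  with u show ?thesis
    unfolding trivial_mod_def
    by (intro exI[of _ n] exI[of _ "\<lambda>i. c * \<alpha> i"] exI[of _ u] exI[of _ t]) simp
qed

lemma trivial_mod_diff:
  assumes "trivial_mod S w h" "trivial_mod S w h'"
  shows "trivial_mod S w (h - h')"
  using trivial_mod_add[OF assms(1) trivial_mod_scale[OF assms(2), of "-1"]]
  by (simp add: scale_minus_one)

lemma Q_star_intros:
  "z = {#} \<or> z \<in> Q \<Longrightarrow> add_mset (Gen None) (embed z) \<in> Q_star"
  "c \<in> Q_star \<Longrightarrow> z \<in> Q \<Longrightarrow> c + embed z \<in> Q_star"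
  "c \<in> Q_star \<Longrightarrow> {#Op c#} \<in> Q_star"
  by (auto simp: Q_star_def Q_add_mset embed_Q)

text \<open>The context is the star times \<open>z\<close>. Its word at the leading word of the
  relation is \<open>D(pq)z\<close>, which the degree bound puts below \<open>D(t)\<close>.\<close>

lemma trivial_mod_mon_times_relation:
  assumes "z \<in> Q" "p \<in> Q" "q \<in> Q" "deg z + deg p + deg q \<le> deg t"
  shows "trivial_mod (leibniz_relations lam) {#Op t#} (mon z * leibniz_defect lam (mon p) (mon q))"
    (is "trivial_mod ?S _ (mon z * ?f)")
proof -
  have "?f \<in> ?S" using assms by (auto simp: leibniz_relations_def)
  moreover have "{#Op t#} \<succ> {#Op (p + q)#} + z"
    using assms by (intro word_gt_Op_product) (auto simp: deg_pos)
  ultimately have "trivial_mod ?S {#Op t#} (subst_poly (add_mset (Gen None) (embed z)) ?f)"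
    using assms by (intro trivial_mod_context) (simp_all add: Q_star_intros leibniz_defect_props)
  then show ?thesis by (simp add: mult.commute)
qed

text \<open>Setting \<open>D(1) = 0\<close> makes the defect of a pair with an empty factor vanish, so that factors of
  the refinement may be empty.\<close>

definition dword :: "'x word \<Rightarrow> ('x, 'k::comm_ring_1) oppoly" where
  "dword u = (if u = {#} then 0 else mon {#Op u#})"

definition word_defect :: "'k \<Rightarrow> 'x word \<Rightarrow> 'x word \<Rightarrow> ('x, 'k::comm_ring_1) oppoly" where
  "word_defect lam u v =
    dword (u + v) - dword u * mon v - mon u * dword v - scale lam (dword u * dword v)"

lemma word_defect_eq:
  "word_defect lam u v = (if u = {#} \<or> v = {#} then 0 else leibniz_defect lam (mon u) (mon v))"
  by (auto simp: word_defect_def dword_def leibniz_defect_def scale_eq simp flip: mon_add)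

lemma trivial_mod_mon_times_word_defect:
  assumes "z \<in> Q" "p = {#} \<or> p \<in> Q" "q = {#} \<or> q \<in> Q" "deg z + deg p + deg q \<le> deg t"
  shows "trivial_mod (leibniz_relations lam) {#Op t#} (mon z * word_defect lam p q)"
  using trivial_mod_mon_times_relation[of z p q t] assms
  by (auto simp: word_defect_eq trivial_mod_0)

text \<open>These are the corrections from expanding \<open>D(pq)\<close> and then
  \<open>D(rs)\<close> in the relation for \<open>pq\<close> and \<open>rs\<close>. Subtracting
  \<open>word_defect lam p q\<close> in the last line leaves the already expanded
  \<open>D(pq)\<close>. So no product of two defects occurs, and each summand is a scalar multiple
  of a word times one defect.\<close>

lemma regrouping_trivial:
  assumes "p + q \<in> Q" "r + s \<in> Q" "t = p + q + (r + s)"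
  shows "trivial_mod (leibniz_relations lam) {#Op t#}
    (word_defect lam p q * (mon (r + s) + scale lam (dword (r + s))) +
     (mon (p + q) + scale lam (dword (p + q) - word_defect lam p q)) * word_defect lam r s)"
proof -
  let ?S = "leibniz_relations lam"
  have Q: "x = {#} \<or> x \<in> Q" if "x \<in> {p, q, r, s}" for x
    using that assms(1,2) by (auto simp: Q_iff)
  note Qs = Q[of p, simplified] Q[of q, simplified] Q[of r, simplified] Q[of s, simplified]
  have ne: "p + q \<noteq> {#}" "r + s \<noteq> {#}" using assms by (auto simp: Q_iff)
  have op: "{#Op x#} \<in> Q" if "x \<in> Q" for x using that by (simp add: Q_add_mset)
  have 1: "trivial_mod ?S {#Op t#} (mon z * word_defect lam p q)" if "z \<in> Q" "deg z = deg (r + s)" for z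
    using that assms Qs by (intro trivial_mod_mon_times_word_defect) auto
  have 2: "trivial_mod ?S {#Op t#} (mon z * word_defect lam r s)" if "z \<in> Q" "deg z = deg (p + q)" for z
    using that assms Qs by (intro trivial_mod_mon_times_word_defect) auto
  \<comment> \<open>The expanded \<open>D(pq)\<close> has three terms, treated in \<open>3\<close>,
    \<open>4\<close> and \<open>5\<close>. A factor \<open>D(1)\<close> makes a term vanish;
    otherwise the cofactor is a word of the same degree as \<open>pq\<close>.\<close>
  have 3: "trivial_mod ?S {#Op t#} (dword p * mon q * word_defect lam r s)"
  proof (cases "p = {#}")
    case False
    then have "dword p * mon q = mon ({#Op p#} + q)" by (simp add: dword_def mult_single)
    moreover have "{#Op p#} + q \<in> Q" using Qs False by (auto simp: Q_add_mset)
    moreover have "deg ({#Op p#} + q) = deg (p + q)" by simp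
    ultimately show ?thesis using 2 by metis
  qed (simp add: dword_def trivial_mod_0)
  have 4: "trivial_mod ?S {#Op t#} (mon p * dword q * word_defect lam r s)"
  proof (cases "q = {#}")
    case False
    then have "mon p * dword q = mon (p + {#Op q#})" by (simp add: dword_def mult_single)
    moreover have "p + {#Op q#} \<in> Q" using Qs False by (auto simp: Q_add_mset)
    moreover have "deg (p + {#Op q#}) = deg (p + q)" by simp
    ultimately show ?thesis using 2 by metis
  qed (simp add: dword_def trivial_mod_0)
  have 5: "trivial_mod ?S {#Op t#} (dword p * dword q * word_defect lam r s)"
  proof (cases "p = {#} \<or> q = {#}")
    case False
    then have "dword p * dword q = mon ({#Op p#} + {#Op q#})" by (simp add: dword_def mult_single)
    moreover have "{#Op p#} + {#Op q#} \<in> Q" using Qs False by (auto simp: Q_add_mset)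
    moreover have "deg ({#Op p#} + {#Op q#}) = deg (p + q)" by simp
    ultimately show ?thesis using 2 by metis
  qed (auto simp: dword_def trivial_mod_0)
  have "word_defect lam p q * (mon (r + s) + scale lam (dword (r + s))) +
     (mon (p + q) + scale lam (dword (p + q) - word_defect lam p q)) * word_defect lam r s =
    mon (r + s) * word_defect lam p q + scale lam (mon {#Op (r + s)#} * word_defect lam p q) +
    (mon (p + q) * word_defect lam r s + scale lam (dword p * mon q * word_defect lam r s +
      mon p * dword q * word_defect lam r s + scale lam (dword p * dword q * word_defect lam r s)))"
  proof -
    have pq_eq: "dword (p + q) - word_defect lam p q =
        dword p * mon q + mon p * dword q + scale lam (dword p * dword q)"
      by (simp add: word_defect_def)
    \<comment> \<open>Since \<open>rs\<close> is nonempty, \<open>D(rs)\<close> is a word of the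
      degree of \<open>rs\<close>, and \<open>1\<close> applies to it.\<close>
    have rs_eq: "dword (r + s) = mon {#Op (r + s)#}" using ne(2) by (simp only: dword_def if_False)
    show ?thesis
      unfolding pq_eq rs_eq scale_eq by (simp only: algebra_simps)
  qed
  moreover have "trivial_mod ?S {#Op t#} \<dots>"
    using assms(1,2)
    by (intro trivial_mod_add trivial_mod_scale 1 2 3 4 5) (simp_all add: op)
  ultimately show ?thesis by simp
qed

text \<open>Expanding \<open>D\<close> on \<open>(pq)(rs)\<close> down to \<open>p, q, r, s\<close> leaves a main term symmetric in \<open>q\<close> and \<open>r\<close>.\<close>

lemma word_defect_regroup:
  "word_defect lam (p + q) (r + s) - word_defect lam (p + r) (q + s) =
    (word_defect lam p r * (mon (q + s) + scale lam (dword (q + s))) +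
     (mon (p + r) + scale lam (dword (p + r) - word_defect lam p r)) * word_defect lam q s) -
    (word_defect lam p q * (mon (r + s) + scale lam (dword (r + s))) +
     (mon (p + q) + scale lam (dword (p + q) - word_defect lam p q)) * word_defect lam r s)"
proof -
  \<comment> \<open>Both groupings have the same product, so the leading words cancel and an
    identity of commutative algebra remains.\<close>
  have "dword (p + q + (r + s)) = (dword (p + r + (q + s)) :: ('a, 'b) oppoly)"
    by (simp add: ac_simps)
  then show ?thesis
    unfolding word_defect_def scale_eq mon_add by (simp add: algebra_simps)
qed

section \<open>The two kinds of inclusion composition\<close>

lemma multiset_refinement:
  fixes u v a b :: "'a multiset"
  assumes "u + v = a + b"
  obtains p q r s where "u = p + q" "v = r + s" "a = p + r" "b = q + s"
proof
  have *: "count u l + count v l = count a l + count b l" for l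
    using assms by (metis count_union)
  \<comment> \<open>Here \<open>p\<close> is the common part of \<open>u\<close> and
    \<open>a\<close>, while \<open>q\<close> and \<open>r\<close> are what is left of
    \<open>u\<close> and of \<open>a\<close>. Finally \<open>s\<close> is \<open>v\<close> without
    \<open>r\<close>, which divides \<open>v\<close> because \<open>a\<close> divides
    \<open>uv\<close>.\<close>
  show "u = u \<inter># a + (u - a)" "a = u \<inter># a + (a - u)"
    by (auto simp: multiset_eq_iff)
  show "v = (a - u) + (v - (a - u))"
  proof (rule multiset_eqI)
    fix l show "count v l = count ((a - u) + (v - (a - u))) l"
      using *[of l] unfolding count_union count_diff by linarith
  qed
  show "b = (u - a) + (v - (a - u))"
  proof (rule multiset_eqI)
    fix l show "count b l = count ((u - a) + (v - (a - u))) l"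
      using *[of l] unfolding count_union count_diff by linarith
  qed
qed

lemma trivial_mod_equal_lead:
  assumes "u \<in> Q" "v \<in> Q" "a \<in> Q" "b \<in> Q" "u + v = a + b"
  shows "trivial_mod (leibniz_relations lam) {#Op (u + v)#}
    (leibniz_defect lam (mon u) (mon v) - leibniz_defect lam (mon a) (mon b))"
proof -
  obtain p q r s where d: "u = p + q" "v = r + s" "a = p + r" "b = q + s"
    using multiset_refinement[OF assms(5)] by blast
  \<comment> \<open>The words \<open>u\<close>, \<open>v\<close>, \<open>a\<close>, \<open>b\<close>
    are nonempty, so the convention \<open>D(1) = 0\<close> affects only the refinement.\<close>
  have "word_defect lam u v - word_defect lam a b =
      leibniz_defect lam (mon u) (mon v) - leibniz_defect lam (mon a) (mon b)"
    using assms by (auto simp: word_defect_eq)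
  moreover have "trivial_mod (leibniz_relations lam) {#Op (u + v)#}
      (word_defect lam u v - word_defect lam a b)"
    unfolding d word_defect_regroup using assms
    by (intro trivial_mod_diff regrouping_trivial) (simp_all add: d ac_simps)
  ultimately show ?thesis by simp
qed

text \<open>Let \<open>G\<close> be the inner relation placed in \<open>q\<close>, and write
  \<open>u = G + R\<close>. The defect at \<open>u\<close> splits by additivity. In the part at
  \<open>G\<close>, \<open>D(Gv)\<close> cancels against the inner reduction and the other three
  terms are contexts of the inner relation; the part at \<open>R\<close> is a combination of
  relations with smaller leading words.\<close>

lemma trivial_mod_nested:
  fixes lam :: "'k::comm_ring_1" and u :: "'x::wellorder word"
  assumes q: "q \<in> Q_star" and Q: "v \<in> Q" "a \<in> Q" "b \<in> Q"
    and u: "u = subst_word q {#Op (a + b)#}"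
  shows "trivial_mod (leibniz_relations lam) {#Op (u + v)#}
    (leibniz_defect lam (mon u) (mon v) -
      Dop (subst_poly q (leibniz_defect lam (mon a) (mon b)) * mon v))"
proof -
  let ?S = "leibniz_relations lam" and ?w = "{#Op (u + v)#}"
  let ?g = "leibniz_defect lam (mon a) (mon b)"
  let ?G = "subst_poly q ?g"
  have star: "q \<in> Q" "count (gens q) None = 1" using q by (auto simp: Q_star_def)
  have uQ: "u \<in> Q" unfolding u using star(1) Q by (intro subst_word_Q) (simp_all add: Q_add_mset)
  have g: "?g \<in> ?S" "lead ?g = {#Op (a + b)#}"
    using Q by (auto simp: leibniz_relations_def leibniz_defect_props)
  \<comment> \<open>The non-leading words of the inner relation; placed in \<open>q\<close> they
    make up \<open>R\<close>.\<close>
  define r1 r2 r3 where "r1 = {#Op a#} + b" and "r2 = a + {#Op b#}" and "r3 = {#Op a#} + {#Op b#}"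
  have lower: "r \<in> Q" "{#Op (a + b)#} \<succ> r" if "r \<in> {r1, r2, r3}" for r
    using leibniz_lower_words[OF Q(2,3)] that unfolding r1_def r2_def r3_def by blast+
  define R where "R = mon (subst_word q r1) + mon (subst_word q r2) + scale lam (mon (subst_word q r3))"
  have G: "?G = mon u - R"
    using star(2) unfolding leibniz_defect_mon r1_def[symmetric] r2_def[symmetric] r3_def[symmetric]
    by (simp add: R_def u subst_poly_linear)
  have low: "trivial_mod ?S ?w (leibniz_defect lam (mon (subst_word q r)) (mon v))"
    if r: "r \<in> {r1, r2, r3}" for r
  proof -
    let ?f = "leibniz_defect lam (mon (subst_word q r)) (mon v) :: ('x, 'k) oppoly"
    have rQ: "subst_word q r \<in> Q" using lower(1)[OF r] star(1) by (simp add: subst_word_Q)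
    then have "?f \<in> ?S" using Q by (auto simp: leibniz_relations_def)
    \<comment> \<open>The bare star: this relation is used without surroundings.\<close>
    moreover have "{#Gen None#} \<in> Q_star" using Q_star_intros(1)[of "{#}"] by simp
    moreover have "?w \<succ> {#Op (subst_word q r + v)#}"
      unfolding u using star(2) lower(2)[OF r] by (intro word_gt_Op word_gt_add subst_word_gt)
    ultimately show ?thesis
      using trivial_mod_context[of "{#Gen None#}" ?f ?S ?w] rQ Q by (simp add: leibniz_defect_props)
  qed
  have ctx: "trivial_mod ?S ?w (subst_poly c ?g)"
    if "c \<in> Q_star" "?w \<succ> subst_word c {#Op (a + b)#}" for c
    using that g by (intro trivial_mod_context) auto
  have opv: "{#Op v#} \<in> Q" using Q by (simp add: Q_add_mset)
  have opq: "{#Op q#} \<in> Q_star" by (rule Q_star_intros(3)[OF q])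
  have pos: "deg u > 0" "deg v > 0" using uQ Q by (simp_all add: deg_pos)
  have gt: "?w \<succ> u + {#Op v#}" "?w \<succ> {#Op u#} + v" "?w \<succ> {#Op u#} + {#Op v#}"
    using pos by (intro word_gt_Op_product; simp)+
  \<comment> \<open>The contexts for \<open>1\<close>, \<open>2\<close>, \<open>3\<close> are
    \<open>q D(v)\<close>, \<open>D(q) v\<close> and \<open>D(q) D(v)\<close>; filled with
    \<open>D(ab)\<close> they become the lower words of the outer relation.\<close>
  have 1: "trivial_mod ?S ?w (?G * mon {#Op v#})"
    using ctx[OF Q_star_intros(2)[OF q opv]] gt(1)
    by (simp only: subst_word_simps(3) subst_embed u[symmetric] subst_poly_simps(3) subst_poly_embed)
  have sub: "subst_word {#Op q#} {#Op (a + b)#} = {#Op u#}" "subst_poly {#Op q#} ?g = Dop ?G"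
    by (simp_all add: u)
  have 2: "trivial_mod ?S ?w (Dop ?G * mon v)"
    using ctx[OF Q_star_intros(2)[OF opq Q(1)]] gt(2)
    by (simp only: subst_word_simps(3) subst_embed sub subst_poly_simps(3) subst_poly_embed)
  have 3: "trivial_mod ?S ?w (Dop ?G * mon {#Op v#})"
    using ctx[OF Q_star_intros(2)[OF opq opv]] gt(3)
    by (simp only: subst_word_simps(3) subst_embed sub subst_poly_simps(3) subst_poly_embed)
  have "leibniz_defect lam (mon u) (mon v) = leibniz_defect lam ?G (mon v) + leibniz_defect lam R (mon v)"
    by (simp add: G flip: leibniz_defect_linear(1))
  then have "leibniz_defect lam (mon u) (mon v) - Dop (?G * mon v) =
      leibniz_defect lam R (mon v) -
        (Dop ?G * mon v + ?G * mon {#Op v#} + scale lam (Dop ?G * mon {#Op v#}))"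
    by (simp add: leibniz_defect_def[of lam ?G])
  moreover have "trivial_mod ?S ?w \<dots>"
    unfolding R_def leibniz_defect_linear
    by (intro trivial_mod_diff trivial_mod_add trivial_mod_scale low 1 2 3) simp_all
  ultimately show ?thesis by simp
qed

text \<open>The star is replaced by a single letter, so the star-carrying letter of \<open>c\<close>
  becomes one letter \<open>m\<close>, which cannot be shared between \<open>u\<close> and
  \<open>v\<close>. A factor containing \<open>m\<close> receives the star, and the other is a
  star-free cofactor.\<close>

lemma star_word_factorization:
  assumes c: "c \<in> Q_star" and eq: "subst_word c {#l#} = u + v" and Q: "u \<in> Q" "v \<in> Q"
  shows "(\<exists>q\<in>Q_star. c = q + embed v \<and> subst_word q {#l#} = u) \<or>
    (\<exists>q\<in>Q_star. c = q + embed u \<and> subst_word q {#l#} = v)"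
proof -
  have cQ: "c \<in> Q" "count (gens c) None = 1" using c by (auto simp: Q_star_def)
  obtain p r where p: "c = add_mset p r" "count (letter_gens p) None = 1" "count (gens r) None = 0"
    using star_word_split[OF cQ(2)] by blast
  obtain t where t: "r = embed t" using starless_eq_embed[OF p(3)] by blast
  obtain m where m: "subst_word_letter {#l#} p = {#m#}"
    using star_letter_cases[OF p(2)]
    by (metis option.simps(4) subst_word_letter.simps(1) subst_word_letter_Op)
  have sum: "add_mset m t = u + v" using eq by (simp add: p(1) t m)
  have factor: "\<exists>q\<in>Q_star. c = q + embed y \<and> subst_word q {#l#} = x"
    if x: "x \<in> Q" "m \<in># x" "add_mset m t = x + y" for x y
  proof -
    obtain x' where x': "x = add_mset m x'" using x(2) by (metis multi_member_split)
    then have t': "t = x' + y" using x(3) by simp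
    have "x' = {#} \<or> x' \<in> Q" using x(1) by (simp add: x' Q_add_mset)
    then have "add_mset p (embed x') \<in> Q_star"
      using cQ(1) p(2) embed_Q[of x'] by (auto simp: p(1) Q_add_mset Q_star_def)
    moreover have "c = add_mset p (embed x') + embed y" by (simp add: p(1) t t')
    moreover have "subst_word (add_mset p (embed x')) {#l#} = x" by (simp add: m x')
    ultimately show ?thesis by blast
  qed
  have "m \<in># u \<or> m \<in># v" using sum by (metis union_iff union_single_eq_member add_mset_add_single)
  then show ?thesis using factor[of u v] factor[of v u] Q sum by (auto simp: add.commute)
qed

text \<open>The leading word is one letter, so the context is one letter too: the star itself,
  giving equal leading words, or some \<open>D(d)\<close> with the star in \<open>d\<close>, giving
  a nested overlap.\<close>

lemma trivial_mod_inclusion: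
  assumes c: "c \<in> Q_star" and Q: "u \<in> Q" "v \<in> Q" "a \<in> Q" "b \<in> Q"
    and eq: "{#Op (u + v)#} = subst_word c {#Op (a + b)#}"
  shows "trivial_mod (leibniz_relations lam) {#Op (u + v)#}
    (leibniz_defect lam (mon u) (mon v) - subst_poly c (leibniz_defect lam (mon a) (mon b)))"
proof -
  have star: "c \<in> Q" "count (gens c) None = 1" using c by (auto simp: Q_star_def)
  obtain p r where p: "c = add_mset p r" "count (letter_gens p) None = 1" "count (gens r) None = 0"
    using star_word_split[OF star(2)] by blast
  obtain t where t: "r = embed t" using starless_eq_embed[OF p(3)] by blast
  from p(2) show ?thesis
  proof (cases p rule: star_letter_cases)
    case 1
    then have "t = {#}" "u + v = a + b" using eq by (auto simp: p(1) t)
    then show ?thesis using trivial_mod_equal_lead[of u v a b lam] Q by (simp add: p(1) t 1)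
  next
    case (2 d)
    then have d: "t = {#}" "u + v = subst_word d {#Op (a + b)#}" using eq by (auto simp: p(1) t)
    then have c_eq: "c = {#Op d#}" by (simp add: p(1) t 2)
    have "d \<in> Q_star" using star 2(2) by (simp add: c_eq Q_add_mset Q_star_def)
    from star_word_factorization[OF this d(2)[symmetric] Q(1,2)]
    consider q where "q \<in> Q_star" "d = q + embed v" "u = subst_word q {#Op (a + b)#}"
      | q where "q \<in> Q_star" "d = q + embed u" "v = subst_word q {#Op (a + b)#}"
      by auto
    then show ?thesis
    proof cases
      case (1 q)
      then show ?thesis using trivial_mod_nested[OF 1(1) Q(2-4) 1(3)] by (simp add: c_eq)
    next
      case (2 q)
      \<comment> \<open>An overlap inside \<open>v\<close> is one inside \<open>u\<close> with the
        factors swapped, and the defect is symmetric.\<close>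
      then show ?thesis using trivial_mod_nested[OF 2(1) Q(1,3,4) 2(3), of lam]
        by (simp add: c_eq add.commute leibniz_defect_commute)
    qed
  qed
qed

theorem theorem5p1:
  fixes lam :: "'k::comm_ring_1"
  shows "GS_basis
    {Dop (mon (u + v)) - Dop (mon u) * mon v - mon u * Dop (mon v)
        - scale lam (Dop (mon u) * Dop (mon v)) :: ('x::wellorder, 'k) oppoly
     | u v. u \<in> Q \<and> v \<in> Q}"
proof -
  have "trivial_mod (leibniz_relations lam) w h"
    if fg: "f \<in> leibniz_relations lam" "g \<in> leibniz_relations lam" and comp: "composition f g w h"
    for f g h :: "('x, 'k) oppoly" and w
  proof -
    obtain u v a b where f: "f = leibniz_defect lam (mon u) (mon v)" "u \<in> Q" "v \<in> Q"
      and g: "g = leibniz_defect lam (mon a) (mon b)" "a \<in> Q" "b \<in> Q"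
      using fg by (auto simp: leibniz_relations_def)
    have lead: "lead f = {#Op (u + v)#}" "lead g = {#Op (a + b)#}"
      using f g by (simp_all add: leibniz_defect_props)
    from comp show ?thesis
    proof cases
      case (intersection x y)
      \<comment> \<open>The word \<open>w\<close> has fewer than two letters and contains the one
        letter of \<open>lead f\<close>, so \<open>x\<close> is empty, contrary to
        \<open>x \<in> Q\<close>.\<close>
      then have "x = {#}" by (simp add: lead bre_def)
      with intersection show ?thesis by simp
    next
      case (inclusion c)
      then show ?thesis
        using trivial_mod_inclusion[of c u v a b lam] f g lead by simp
    qed
  qed
  moreover have "leibniz_relations lam \<subseteq> (KXD :: ('x, 'k) oppoly set)"
    "\<forall>f \<in> (leibniz_relations lam :: ('x, 'k) oppoly set). monic f"
    by (auto simp: leibniz_relations_def leibniz_defect_props)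
  ultimately have "GS_basis (leibniz_relations lam :: ('x, 'k) oppoly set)"
    unfolding GS_basis_def by blast
  \<comment> \<open>The theorem writes the argument of \<open>D\<close> as the monomial of a product
    word, the defect as a product of two monomials.\<close>
  then show ?thesis
    unfolding leibniz_relations_def leibniz_defect_def by (simp only: mon_add)
qed

end
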